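(* Let $\mathcal{A}$ be a multiplicative type-C algebra. Then $\mathrm{Ld}(\mathcal{A})=\mathcal{A}^\times$.
   Context: An algebra is a finite-dimensional associative commutative unital algebra over $\mathbb{R}$, with product $\star$. The exponential is $\exp(z)=e^z=\sum_{k\ge0} z^k/k!$, convergent for all $z\in\mathcal{A}$; $\mathrm{Ld}(\mathcal{A})=\exp(\mathcal{A})$ denotes its image, and $\mathcal{A}^\times$ is the group of units of $\mathcal{A}$. A basis $\{v_1,\dots,v_n\}$ of an algebra is multiplicative if for all $i,j$ there are $c\in\mathbb{R}$ and a basis element $v_k$ with $v_i\star v_j=c\,v_k$; an algebra is multiplicative if it admits a multiplicative basis. An algebra $\mathcal{A}$ is type-C if there is an algebra $\mathcal{B}$ with $\mathcal{A}\cong\mathbb{C}\otimes_{\mathbb{R}}\mathcal{B}$ as real algebras. *)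

theory Defs
  imports Complex_Main "Jordan_Normal_Form.VS_Connect" "HOL-Algebra.QuotRing"
    "HOL-Library.Poly_Mapping"
begin

section \<open>Real algebras\<close>

text \<open>\<^const>\<open>class_ring\<close> at type \<^typ>\<open>real\<close> is the field of real numbers as a structure.
  \<^locale>\<open>algebra\<close> already includes associativity, commutativity and a unit. The zero algebra is
  allowed.\<close>

locale real_algebra =
  algebra "class_ring :: real ring" A + vectorspace "class_ring :: real ring" A
  for A :: "(real, 'a) module" (structure) +
  assumes finite_dimensional: "fin_dim"

definition class_algebra :: "(real, 'a :: real_algebra_1) module" where
  "class_algebra =
    \<lparr> carrier = UNIV, mult = (*), one = 1, zero = 0, add = (+), smult = scaleR \<rparr>"

definition algebra_iso :: "(real, 'a) module \<Rightarrow> (real, 'b) module \<Rightarrow> ('a \<Rightarrow> 'b) set" where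
  "algebra_iso A B = ring_iso A B \<inter> LinearCombinations.module_hom class_ring A B"


section \<open>The exponential\<close>

text \<open>Convergence in the canonical topology of a finite-dimensional real vector space, in the
  basis-free form: every real linear functional converges. Taking the functionals to be the
  coordinates with respect to any basis shows that this is coordinatewise convergence; in
  particular limits are unique.\<close>

definition algebra_tendsto :: "(real, 'a) module \<Rightarrow> (nat \<Rightarrow> 'a) \<Rightarrow> 'a \<Rightarrow> bool" where
  "algebra_tendsto A X l \<longleftrightarrow> l \<in> carrier A \<and>
    (\<forall>\<phi> \<in> LinearCombinations.module_hom class_ring A (class_algebra :: (real, real) module).
      (\<lambda>n. \<phi> (X n)) \<longlonglongrightarrow> \<phi> l)"

definition algebra_exp :: "(real, 'a) module \<Rightarrow> 'a \<Rightarrow> 'a" where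
  "algebra_exp A z =
    (THE w. algebra_tendsto A
      (\<lambda>n. \<Oplus>\<^bsub>A\<^esub> k \<in> {..<n}. (1 / fact k) \<odot>\<^bsub>A\<^esub> (z [^]\<^bsub>A\<^esub> (k :: nat))) w)"

definition Ld :: "(real, 'a) module \<Rightarrow> 'a set" where
  "Ld A = algebra_exp A ` carrier A"


section \<open>Multiplicative algebras\<close>

definition multiplicative_basis :: "(real, 'a) module \<Rightarrow> 'a set \<Rightarrow> bool" where
  "multiplicative_basis A V \<longleftrightarrow> vectorspace.basis class_ring A V \<and>
    (\<forall>v \<in> V. \<forall>w \<in> V. \<exists>c :: real. \<exists>u \<in> V. v \<otimes>\<^bsub>A\<^esub> w = c \<odot>\<^bsub>A\<^esub> u)"

definition multiplicative_algebra :: "(real, 'a) module \<Rightarrow> bool" where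
  "multiplicative_algebra A \<longleftrightarrow> (\<exists>V. multiplicative_basis A V)"


section \<open>Tensor products and type-C algebras\<close>

text \<open>The tensor product of two real algebras is the quotient of the free real vector space on
  pairs by the subspace spanned by the bilinearity relators. The free space carries the bilinear
  product that multiplies basis pairs componentwise; the relator subspace is an ideal for it, so
  the ring quotient \<^const>\<open>FactRing\<close> applies, and scalars act on cosets through representatives.\<close>

definition pair_algebra ::
    "(real, 'a) module \<Rightarrow> (real, 'b) module \<Rightarrow> (real, ('a \<times> 'b) \<Rightarrow>\<^sub>0 real) module" where
  "pair_algebra A B =
    \<lparr> carrier = {f. Poly_Mapping.keys f \<subseteq> carrier A \<times> carrier B},
      mult = (\<lambda>f g. \<Sum>p \<in> Poly_Mapping.keys f. \<Sum>q \<in> Poly_Mapping.keys g.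
        Poly_Mapping.single (fst p \<otimes>\<^bsub>A\<^esub> fst q, snd p \<otimes>\<^bsub>B\<^esub> snd q)
          (Poly_Mapping.lookup f p * Poly_Mapping.lookup g q)),
      one = Poly_Mapping.single (\<one>\<^bsub>A\<^esub>, \<one>\<^bsub>B\<^esub>) 1,
      zero = 0,
      add = (+),
      smult = (\<lambda>r. Poly_Mapping.map ((*) r)) \<rparr>"

definition tensor_relators ::
    "(real, 'a) module \<Rightarrow> (real, 'b) module \<Rightarrow> (('a \<times> 'b) \<Rightarrow>\<^sub>0 real) set" where
  "tensor_relators A B =
    (let \<delta> = (\<lambda>a b. Poly_Mapping.single (a, b) (1 :: real)) in
      {\<delta> (a \<oplus>\<^bsub>A\<^esub> a') b - \<delta> a b - \<delta> a' b | a a' b.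
        a \<in> carrier A \<and> a' \<in> carrier A \<and> b \<in> carrier B} \<union>
      {\<delta> a (b \<oplus>\<^bsub>B\<^esub> b') - \<delta> a b - \<delta> a b' | a b b'.
        a \<in> carrier A \<and> b \<in> carrier B \<and> b' \<in> carrier B} \<union>
      {\<delta> (r \<odot>\<^bsub>A\<^esub> a) b - Poly_Mapping.map ((*) r) (\<delta> a b) | r a b.
        a \<in> carrier A \<and> b \<in> carrier B} \<union>
      {\<delta> a (r \<odot>\<^bsub>B\<^esub> b) - Poly_Mapping.map ((*) r) (\<delta> a b) | r a b.
        a \<in> carrier A \<and> b \<in> carrier B})"

definition tensor_algebra ::
    "(real, 'a) module \<Rightarrow> (real, 'b) module \<Rightarrow> (real, (('a \<times> 'b) \<Rightarrow>\<^sub>0 real) set) module" where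
  "tensor_algebra A B =
    (let F = pair_algebra A B; I = LinearCombinations.module.span class_ring F (tensor_relators A B) in
      ring.extend (F Quot I)
        (module.fields (\<lambda>r X. \<Union>x \<in> X. I +>\<^bsub>F\<^esub> (r \<odot>\<^bsub>F\<^esub> x))))"

text \<open>A formula cannot quantify over types, so the carrier type of the witness is a type argument;
  a theorem assuming \<open>type_C TYPE('b) A\<close> with \<open>'b\<close> a type variable covers witnesses of every
  type.\<close>

definition type_C :: "'b itself \<Rightarrow> (real, 'a) module \<Rightarrow> bool" where
  "type_C _ A \<longleftrightarrow> (\<exists>B :: (real, 'b) module. real_algebra B \<and>
    algebra_iso A (tensor_algebra (class_algebra :: (real, complex) module) B) \<noteq> {})"

end

theory Submission
  imports Defs
    "HOL-Computational_Algebra.Fundamental_Theorem_Algebra"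
    "HOL-Analysis.Complex_Transcendental"
begin

text \<open>
  A type-C algebra contains a square root \<open>j\<close> of \<open>-1\<close>, the image of \<open>i \<otimes> 1\<close>, so it is a
  finite-dimensional commutative algebra over \<open>\<complex>\<close>. Every element \<open>u\<close> is a root of some complex
  polynomial \<open>p \<noteq> 0\<close> (\<open>annihilating_polynomial\<close>), so evaluation at \<open>u\<close> factors through \<open>\<complex>[X]\<close>
  modulo \<open>p\<close>, and the exponential can be studied there.

  Modulo \<open>p\<close> the exponential series converges and turns sums into products (\<open>exp_mod_add\<close>); in
  particular \<open>exp z\<close> is inverse to \<open>exp (- z)\<close>, so exponentials are units. Conversely, if \<open>u\<close> is a
  unit, then \<open>p\<close> can be chosen with \<open>p(0) \<noteq> 0\<close>, and a polynomial \<open>q\<close> with \<open>exp q = X\<close> modulo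
  \<open>p\<close> gives \<open>exp (q(u)) = u\<close>. Such a \<open>q\<close> is built by adjoining the roots of \<open>p\<close> one by one
  (\<open>exp_mod_log\<close>). In passing from \<open>p\<close> to \<open>p (X - z)\<close> the old \<open>q\<close> is correct up to a multiple of
  \<open>p\<close>, and a correction \<open>q + t p\<close> repairs it, because \<open>p\<^sup>2 = p(z) p\<close> modulo \<open>p (X - z)\<close> makes
  \<open>exp (t p)\<close> explicit. This uses complex scalars twice: for \<open>p\<close> to split, and for the nonzero
  scalar \<open>1 + f p(z)\<close> that the correction requires to have a logarithm.

  Finding \<open>j\<close> requires that products of cosets in the tensor product can be computed on
  representatives, that is, that the span of the bilinearity relators is an ideal
  (\<open>I_absorbs\<close>, \<open>tensor_mult\<close>).
\<close>


section \<open>The exponential modulo a complex polynomial\<close>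

text \<open>The relation \<open>exp q = r\<close> in the quotient of \<open>\<complex>[X]\<close> by the ideal of \<open>p\<close>, phrased with
  representatives: the exponential series converges coordinatewise with respect to the monomial
  basis of remainders modulo \<open>p\<close>. Working with representatives keeps all ring identities inside
  the type of complex polynomials.\<close>

definition exp_mod :: "complex poly \<Rightarrow> complex poly \<Rightarrow> complex poly \<Rightarrow> bool" where
  "exp_mod p q r \<longleftrightarrow> (\<forall>i. (\<lambda>k. coeff (q ^ k mod p) i / fact k) sums coeff (r mod p) i)"

lemma coeff_mod_sum:
  fixes p :: "complex poly"
  shows "coeff ((\<Sum>x\<in>S. f x) mod p) m = (\<Sum>x\<in>S. coeff (f x mod p) m)"
  by (induction S rule: infinite_finite_induct) (auto simp: poly_mod_add_left)

lemma coeff_mod_smult: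
  fixes p :: "complex poly"
  shows "coeff (Polynomial.smult c q mod p) m = c * coeff (q mod p) m"
  by (simp add: mod_smult_left)

lemma mod_eq_sum_monom:
  fixes p q :: "complex poly"
  assumes "p \<noteq> 0"
  shows "q mod p = (\<Sum>l<degree p. monom (coeff (q mod p) l) l)"
proof (rule poly_eqI)
  fix n
  have "coeff (q mod p) n = 0" if "\<not> n < degree p"
    using degree_mod_less[OF assms, of q] that by (auto intro: coeff_eq_0)
  then show "coeff (q mod p) n = coeff (\<Sum>l<degree p. monom (coeff (q mod p) l) l) n"
    by (auto simp: coeff_sum sum.delta')
qed

text \<open>Multiplication modulo \<open>p\<close> is bilinear in the coordinates; the numbers
  \<open>coeff (monom 1 (i + l) mod p) m\<close> are the structure constants of the quotient algebra.\<close>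

lemma coeff_mult_mod:
  fixes p a b :: "complex poly"
  assumes "p \<noteq> 0"
  shows "coeff (a * b mod p) m = (\<Sum>i<degree p. \<Sum>l<degree p.
    coeff (a mod p) i * coeff (b mod p) l * coeff (monom 1 (i + l) mod p) m)"
proof -
  have "a * b mod p = (a mod p) * (b mod p) mod p"
    by (simp add: mod_mult_eq)
  also have "\<dots> = (\<Sum>i<degree p. \<Sum>l<degree p.
      Polynomial.smult (coeff (a mod p) i * coeff (b mod p) l) (monom 1 (i + l))) mod p"
    by (subst mod_eq_sum_monom[OF assms, of a], subst mod_eq_sum_monom[OF assms, of b])
       (simp add: sum_product mult_monom smult_monom)
  finally show ?thesis
    by (simp add: coeff_mod_sum coeff_mod_smult)
qed

text \<open>The \<open>\<ell>\<^sup>1\<close> norm \<open>N\<close> of the coordinates is submultiplicative up to the sum \<open>K\<close> of the absolute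
  values of the structure constants, so \<open>N (q ^ k)\<close> grows at most geometrically.\<close>

lemma summable_coeff_power_mod:
  fixes p q :: "complex poly"
  assumes "p \<noteq> 0"
  shows "summable (\<lambda>k. norm (coeff (q ^ k mod p) i / fact k))"
proof -
  define d where "d = degree p"
  define N where "N a = (\<Sum>i<d. norm (coeff (a mod p) i))" for a
  define K where "K = (\<Sum>m<d. \<Sum>i<d. \<Sum>l<d. norm (coeff (monom 1 (i + l) mod p) m))"
  have N_ge: "norm (coeff (a mod p) i) \<le> N a" for a i
  proof (cases "i < d")
    case True
    then show ?thesis unfolding N_def by (intro member_le_sum) auto
  next
    case False
    then have "coeff (a mod p) i = 0"
      using degree_mod_less[OF assms, of a] by (auto simp: d_def intro: coeff_eq_0)
    then show ?thesis by (simp add: N_def sum_nonneg)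
  qed
  have N_nonneg: "N a \<ge> 0" for a by (simp add: N_def sum_nonneg)
  have K_nonneg: "K \<ge> 0" by (simp add: K_def sum_nonneg)
  have N_mult: "N (a * b) \<le> K * N a * N b" for a b
  proof -
    have "N (a * b) \<le> (\<Sum>m<d. \<Sum>i<d. \<Sum>l<d. N a * N b * norm (coeff (monom 1 (i + l) mod p) m))"
      unfolding N_def[of "a * b"]
    proof (rule sum_mono)
      fix m
      have "norm (coeff (a * b mod p) m) \<le> (\<Sum>i<d. \<Sum>l<d. norm
          (coeff (a mod p) i * coeff (b mod p) l * coeff (monom 1 (i + l) mod p) m))"
        unfolding coeff_mult_mod[OF assms] d_def[symmetric]
        by (intro order.trans[OF norm_sum] sum_mono order.trans[OF norm_sum]) auto
      also have "\<dots> \<le> (\<Sum>i<d. \<Sum>l<d. N a * N b * norm (coeff (monom 1 (i + l) mod p) m))"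
        unfolding norm_mult
        by (intro sum_mono mult_right_mono mult_mono N_ge N_nonneg norm_ge_zero)
      finally show "norm (coeff (a * b mod p) m)
        \<le> (\<Sum>i<d. \<Sum>l<d. N a * N b * norm (coeff (monom 1 (i + l) mod p) m))" .
    qed
    also have "\<dots> = K * N a * N b"
      by (simp add: K_def sum_distrib_left sum_distrib_right mult_ac)
    finally show ?thesis .
  qed
  have N_power: "N (q ^ k) \<le> N 1 * (K * N q) ^ k" for k
  proof (induction k)
    case (Suc k)
    have "N (q ^ Suc k) \<le> K * N q * N (q ^ k)"
      using N_mult[of q "q ^ k"] by simp
    also have "\<dots> \<le> K * N q * (N 1 * (K * N q) ^ k)"
      by (intro mult_left_mono Suc.IH mult_nonneg_nonneg K_nonneg N_nonneg)
    finally show ?case by (simp add: mult_ac)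
  qed simp
  have "summable (\<lambda>k. N 1 * (inverse (fact k) * (K * N q) ^ k))"
    by (intro summable_mult summable_exp)
  then show ?thesis
  proof (rule summable_comparison_test')
    fix k
    have "norm (coeff (q ^ k mod p) i) / fact k \<le> N 1 * (K * N q) ^ k / fact k"
      using order.trans[OF N_ge N_power] by (intro divide_right_mono) auto
    then show "norm (norm (coeff (q ^ k mod p) i / fact k))
        \<le> N 1 * (inverse (fact k) * (K * N q) ^ k)"
      by (simp add: norm_divide field_simps)
  qed
qed

lemma exp_mod_exists:
  assumes "p \<noteq> 0"
  obtains r where "exp_mod p q r"
proof
  define c where "c i = suminf (\<lambda>k. coeff (q ^ k mod p) i / fact k)" for i
  define r where "r = (\<Sum>i<degree p. monom (c i) i)"
  have r: "coeff r i = (if i < degree p then c i else 0)" for i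
    by (auto simp: r_def coeff_sum sum.delta')
  have c: "c i = 0" if "\<not> i < degree p" for i
  proof -
    have "coeff (s mod p) i = 0" for s
      using degree_mod_less[OF assms, of s] that by (auto intro: coeff_eq_0)
    then show ?thesis by (simp add: c_def)
  qed
  have "r mod p = r"
  proof (cases "r = 0")
    case False
    then have "coeff r (degree r) \<noteq> 0" by simp
    then have "degree r < degree p" using r by metis
    then show ?thesis by (rule mod_poly_less)
  qed simp
  moreover have "(\<lambda>k. coeff (q ^ k mod p) i / fact k) sums c i" for i
    unfolding c_def
    by (intro summable_sums summable_norm_cancel[OF summable_coeff_power_mod] assms)
  moreover have "coeff r i = c i" for i
    using r c by (cases "i < degree p") simp_all
  ultimately show "exp_mod p q r"
    by (simp add: exp_mod_def)
qed

text \<open>The addition theorem: expanded by bilinearity, the coordinates of the product are finite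
  combinations of products of absolutely convergent series, and the Cauchy products collect into
  the exponential series of the sum by the binomial theorem.\<close>

lemma exp_mod_add:
  assumes p: "p \<noteq> 0" and "exp_mod p q r" "exp_mod p q' r'"
  shows "exp_mod p (q + q') (r * r')"
  unfolding exp_mod_def
proof
  fix m
  define f where "f i k = coeff (q ^ k mod p) i / fact k" for i k
  define g where "g i k = coeff (q' ^ k mod p) i / fact k" for i k
  define B where "B i l = coeff (monom 1 (i + l) mod p) m" for i l
  have f: "f i sums coeff (r mod p) i" "summable (\<lambda>k. norm (f i k))" for i
    using assms summable_coeff_power_mod[OF p] by (auto simp: exp_mod_def f_def[abs_def])
  have g: "g i sums coeff (r' mod p) i" "summable (\<lambda>k. norm (g i k))" for i
    using assms summable_coeff_power_mod[OF p] by (auto simp: exp_mod_def g_def[abs_def])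
  have "(\<lambda>n. \<Sum>a\<le>n. f i a * g l (n - a)) sums (coeff (r mod p) i * coeff (r' mod p) l)" for i l
    using Cauchy_product_sums[OF f(2) g(2)] f(1) g(1) by (simp add: sums_iff)
  then have "(\<lambda>n. \<Sum>i<degree p. \<Sum>l<degree p. (\<Sum>a\<le>n. f i a * g l (n - a)) * B i l) sums
      (\<Sum>i<degree p. \<Sum>l<degree p. coeff (r mod p) i * coeff (r' mod p) l * B i l)"
    by (intro sums_sum sums_mult2)
  also have "(\<Sum>i<degree p. \<Sum>l<degree p. coeff (r mod p) i * coeff (r' mod p) l * B i l)
      = coeff (r * r' mod p) m"
    by (simp add: coeff_mult_mod[OF p] B_def)
  also have "(\<lambda>n. \<Sum>i<degree p. \<Sum>l<degree p. (\<Sum>a\<le>n. f i a * g l (n - a)) * B i l)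
      = (\<lambda>n. coeff ((q + q') ^ n mod p) m / fact n)"
  proof
    fix n
    have "(\<Sum>i<degree p. \<Sum>l<degree p. (\<Sum>a\<le>n. f i a * g l (n - a)) * B i l)
        = (\<Sum>a\<le>n. \<Sum>i<degree p. \<Sum>l<degree p. f i a * g l (n - a) * B i l)"
      unfolding sum_distrib_right by (simp add: sum.swap[of _ "{..n}"])
    also have "\<dots> = (\<Sum>a\<le>n. coeff (q ^ a * q' ^ (n - a) mod p) m / (fact a * fact (n - a)))"
      by (simp add: coeff_mult_mod[OF p] B_def f_def g_def sum_divide_distrib)
    also have "\<dots> = (\<Sum>a\<le>n. of_nat (n choose a) * coeff (q ^ a * q' ^ (n - a) mod p) m) / fact n"
      unfolding sum_divide_distrib by (intro sum.cong) (auto simp: binomial_fact field_simps)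
    also have "(\<Sum>a\<le>n. of_nat (n choose a) * coeff (q ^ a * q' ^ (n - a) mod p) m)
        = coeff ((q + q') ^ n mod p) m"
      by (simp add: binomial_ring coeff_mod_sum coeff_mod_smult of_nat_poly mult.assoc)
    finally show "(\<Sum>i<degree p. \<Sum>l<degree p. (\<Sum>a\<le>n. f i a * g l (n - a)) * B i l)
        = coeff ((q + q') ^ n mod p) m / fact n" .
  qed
  finally show "(\<lambda>n. coeff ((q + q') ^ n mod p) m / fact n) sums coeff (r * r' mod p) m" .
qed

text \<open>A real-linear map that kills the multiples of \<open>p\<close> factors through the finitely many real and
  imaginary parts of coordinates, hence is continuous and can be applied termwise. The codomain
  is \<open>\<complex>\<close> when comparing different moduli and \<open>\<real>\<close> when testing convergence in a real algebra.\<close>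

lemma exp_mod_functional:
  fixes f :: "complex poly \<Rightarrow> 'v :: real_normed_vector"
  assumes p: "p \<noteq> 0" and "exp_mod p q r"
    and add: "\<And>a b. f (a + b) = f a + f b"
    and scale: "\<And>c a. f (Polynomial.smult (of_real c) a) = c *\<^sub>R f a"
    and ideal: "\<And>a. f (p * a) = 0"
  shows "(\<lambda>k. f (q ^ k) /\<^sub>R fact k) sums f r"
proof -
  have zero: "f 0 = 0" using add[of 0 0] by simp
  have sum: "f (\<Sum>x\<in>S. h x) = (\<Sum>x\<in>S. f (h x))" for S :: "nat set" and h
    by (induction S rule: infinite_finite_induct) (auto simp: add zero)
  have monom: "f (monom c l) = Re c *\<^sub>R f (monom 1 l) + Im c *\<^sub>R f (monom \<i> l)" for c l
  proof -
    have "monom c l = Polynomial.smult (of_real (Re c)) (monom 1 l)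
        + Polynomial.smult (of_real (Im c)) (monom \<i> l)"
      by (simp add: smult_monom add_monom complex_eq mult.commute)
    then show ?thesis by (metis add scale)
  qed
  have f: "f a = (\<Sum>l<degree p. Re (coeff (a mod p) l) *\<^sub>R f (monom 1 l)
      + Im (coeff (a mod p) l) *\<^sub>R f (monom \<i> l))" for a
  proof -
    have "f a = f (p * (a div p) + a mod p)" by simp
    also have "\<dots> = f (a mod p)" unfolding add ideal by simp
    also have "\<dots> = (\<Sum>l<degree p. f (monom (coeff (a mod p) l) l))"
      by (subst mod_eq_sum_monom[OF p]) (rule sum)
    finally show ?thesis unfolding monom[of "coeff _ _"] .
  qed
  have "(\<lambda>k. \<Sum>l<degree p. Re (coeff (q ^ k mod p) l / fact k) *\<^sub>R f (monom 1 l)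
      + Im (coeff (q ^ k mod p) l / fact k) *\<^sub>R f (monom \<i> l)) sums f r"
    unfolding f[of r] using assms(2)
    by (intro sums_sum sums_add bounded_linear.sums[OF bounded_linear_scaleR_left]
      sums_Re sums_Im) (auto simp: exp_mod_def)
  also have "(\<lambda>k. \<Sum>l<degree p. Re (coeff (q ^ k mod p) l / fact k) *\<^sub>R f (monom 1 l)
      + Im (coeff (q ^ k mod p) l / fact k) *\<^sub>R f (monom \<i> l)) = (\<lambda>k. f (q ^ k) /\<^sub>R fact k)"
  proof
    fix k
    have "Re (c / fact k) = inverse (fact k) * Re c \<and> Im (c / fact k) = inverse (fact k) * Im c" for c
      by (metis Re_divide_of_real Im_divide_of_real of_real_fact divide_inverse mult.commute)
    then show "(\<Sum>l<degree p. Re (coeff (q ^ k mod p) l / fact k) *\<^sub>R f (monom 1 l)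
      + Im (coeff (q ^ k mod p) l / fact k) *\<^sub>R f (monom \<i> l)) = f (q ^ k) /\<^sub>R fact k"
      unfolding f[of "q ^ k"] by (simp add: scaleR_sum_right scaleR_add_right)
  qed
  finally show ?thesis .
qed

lemma exp_mod_dvd:
  assumes "p' \<noteq> 0" "exp_mod p' q r" "p dvd p'"
  shows "exp_mod p q r"
  unfolding exp_mod_def
proof
  fix i
  have "(\<lambda>k. coeff (q ^ k mod p) i /\<^sub>R fact k) sums coeff (r mod p) i"
  proof (rule exp_mod_functional[OF assms(1,2), of "\<lambda>a. coeff (a mod p) i"])
    fix a
    have "p dvd p' * a" using assms(3) by simp
    then show "coeff (p' * a mod p) i = 0" by (simp add: dvd_imp_mod_0)
  qed (simp_all add: poly_mod_add_left mod_smult_left scaleR_conv_of_real)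
  then show "(\<lambda>k. coeff (q ^ k mod p) i / fact k) sums coeff (r mod p) i"
    by (simp add: scaleR_conv_of_real divide_inverse mult.commute)
qed

lemma exp_mod_cong:
  assumes "exp_mod p q r" "r mod p = r' mod p"
  shows "exp_mod p q r'"
  using assms by (simp add: exp_mod_def)

lemma exp_mod_unique:
  assumes "exp_mod p q r" "exp_mod p q r'"
  shows "r mod p = r' mod p"
proof (rule poly_eqI)
  fix i
  show "coeff (r mod p) i = coeff (r' mod p) i"
    using assms unfolding exp_mod_def by (blast intro: sums_unique2)
qed

lemma exp_mod_zero: "exp_mod p 0 1"
  unfolding exp_mod_def
proof
  fix i
  have "(\<lambda>k. coeff (0 ^ k mod p) i / fact k) = (\<lambda>k. if k = 0 then coeff (1 mod p) i else 0)"
    by (auto simp: fun_eq_iff power_0_left)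
  then show "(\<lambda>k. coeff (0 ^ k mod p) i / fact k) sums coeff (1 mod p) i"
    using sums_single[of 0 "\<lambda>_. coeff (1 mod p) i"] by simp
qed

lemma exp_mod_inverse:
  assumes p: "p \<noteq> 0" and "exp_mod p q r"
  obtains r' where "exp_mod p (- q) r'" "r * r' mod p = 1 mod p"
proof -
  obtain r' where r': "exp_mod p (- q) r'" by (rule exp_mod_exists[OF p])
  have "exp_mod p (q + - q) (r * r')" by (intro exp_mod_add assms r')
  then have "r * r' mod p = 1 mod p"
    using exp_mod_zero by (intro exp_mod_unique[of p 0]) simp_all
  with r' show ?thesis by (rule that)
qed

text \<open>Modulo \<open>p (X - z)\<close> one has \<open>p\<^sup>2 = a p\<close> with \<open>a = p(z)\<close>, because \<open>X - z\<close> divides \<open>p - a\<close>. Thus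
  \<open>p\<close> is nilpotent or a multiple of an idempotent, and the exponential series of \<open>t p\<close> collapses
  to \<open>1 + f p\<close> with \<open>f = \<Sum>\<^sub>k t\<^sup>k a\<^sup>k\<^sup>-\<^sup>1 / k!\<close>, the sum being over \<open>k \<ge> 1\<close>; both cases of the hypothesis
  are closed forms of this number.\<close>

lemma exp_mod_scaled_idempotent:
  fixes p :: "complex poly" and z t f :: complex
  defines "a \<equiv> poly p z"
  assumes f: "if a = 0 then f = t else exp (t * a) = 1 + f * a"
  shows "exp_mod (p * [:- z, 1:]) (Polynomial.smult t p) (1 + Polynomial.smult f p)"
  unfolding exp_mod_def
proof
  fix i
  define m where "m = p * [:- z, 1:]"
  have sq: "p * p mod m = Polynomial.smult a p mod m"
  proof -
    have "[:- z, 1:] dvd p - [:a:]" by (simp add: a_def poly_eq_0_iff_dvd[symmetric])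
    then have "m dvd p * (p - [:a:])" unfolding m_def by (intro mult_dvd_mono) auto
    also have "p * (p - [:a:]) = p * p - Polynomial.smult a p" by (simp add: algebra_simps)
    finally show ?thesis by (simp add: mod_eq_dvd_iff)
  qed
  have power: "p ^ Suc k mod m = Polynomial.smult (a ^ k) p mod m" for k
  proof (induction k)
    case (Suc k)
    have "p ^ Suc (Suc k) mod m = p * (p ^ Suc k mod m) mod m" by (simp add: mod_mult_right_eq)
    also have "\<dots> = Polynomial.smult (a ^ k) (p * p) mod m"
      unfolding Suc.IH by (simp add: mod_mult_right_eq)
    also have "\<dots> = Polynomial.smult (a ^ Suc k) p mod m"
      by (simp add: mod_smult_left sq mult.commute)
    finally show ?case .
  qed simp
  have "(\<lambda>k. t ^ Suc k * a ^ k / fact (Suc k)) sums f"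
  proof (cases "a = 0")
    case True
    then have "(\<lambda>k. t ^ Suc k * a ^ k / fact (Suc k)) = (\<lambda>k. if k = 0 then t else 0)"
      by (auto simp: fun_eq_iff power_0_left)
    then show ?thesis using sums_single[of 0 "\<lambda>_. t"] f True by simp
  next
    case False
    have "(\<lambda>k. (t * a) ^ k / fact k) sums exp (t * a)"
      using exp_converges[of "t * a"] by (simp add: scaleR_conv_of_real divide_inverse mult.commute)
    then have "(\<lambda>k. (t * a) ^ Suc k / fact (Suc k)) sums (exp (t * a) - 1)"
      by (subst sums_Suc_iff) simp
    from sums_divide[OF this, of a] show ?thesis
      using f False by (simp add: field_simps power_mult_distrib del: fact_Suc)
  qed
  moreover have "coeff (Polynomial.smult t p ^ Suc k mod m) i = t ^ Suc k * a ^ k * coeff (p mod m) i" for k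
    by (simp only: smult_power mod_smult_left power coeff_smult mult.assoc)
  ultimately
  have "(\<lambda>k. coeff (Polynomial.smult t p ^ Suc k mod m) i / fact (Suc k)) sums (f * coeff (p mod m) i)"
    using sums_mult2[of "\<lambda>k. t ^ Suc k * a ^ k / fact (Suc k)" f "coeff (p mod m) i"]
    by (simp del: power_Suc fact_Suc)
  then have "(\<lambda>k. coeff (Polynomial.smult t p ^ k mod m) i / fact k)
      sums (f * coeff (p mod m) i + coeff (1 mod m) i)"
    by (subst (asm) sums_Suc_iff) simp
  then show "(\<lambda>k. coeff (Polynomial.smult t p ^ k mod (p * [:- z, 1:])) i / fact k) sums
      coeff ((1 + Polynomial.smult f p) mod (p * [:- z, 1:])) i"
    by (simp add: m_def poly_mod_add_left mod_smult_left add.commute)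
qed

text \<open>A logarithm of \<open>X\<close> exists modulo any \<open>p\<close> at whose roots \<open>X\<close> does not vanish. It is lifted one
  root at a time: if \<open>exp q = X\<close> modulo \<open>p\<close>, then modulo \<open>p (X - z)\<close> one has
  \<open>exp q = r = X + p s\<close>, and the error is removed by adding a suitable multiple \<open>t p\<close> to \<open>q\<close>, since
  \<open>exp (t p) = 1 + f p\<close>. The condition for \<open>r (1 + f p) = X\<close> is \<open>s + f r = 0\<close> at the single point
  \<open>z\<close>, a linear equation for \<open>f\<close>.\<close>

lemma exp_mod_log:
  assumes "p \<noteq> 0" "poly p 0 \<noteq> 0"
  shows "\<exists>q. exp_mod p q [:0, 1:]"
  using assms
proof (induction "degree p" arbitrary: p)
  case 0
  then obtain c where "p = [:c:]" by (metis degree_eq_zeroE)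
  with 0 have "s mod p = 0" for s by (simp add: dvd_imp_mod_0[symmetric] const_poly_dvd_iff dvd_field_iff)
  then show ?case by (auto simp: exp_mod_def)
next
  case (Suc n p')
  then have "\<not> constant (poly p')" by (simp add: constant_degree)
  then obtain z where "poly p' z = 0" using fundamental_theorem_of_algebra by blast
  then obtain p where p': "p' = p * [:- z, 1:]"
    by (metis dvdE mult.commute poly_eq_0_iff_dvd)
  define a where "a = poly p z"
  from Suc.prems p' have p: "p \<noteq> 0" "poly p 0 \<noteq> 0" and z: "z \<noteq> 0" by auto
  have "n = degree p" using Suc.hyps(2) p' p(1) by (simp add: degree_mult_eq del: mult_pCons_right)
  from Suc.hyps(1)[OF this p] obtain q where q: "exp_mod p q [:0, 1:]" by blast
  obtain r where r: "exp_mod p' q r" by (rule exp_mod_exists[OF Suc.prems(1)])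
  have "exp_mod p q r" using p' by (intro exp_mod_dvd[OF Suc.prems(1) r]) (metis dvd_triv_left)
  then have "r mod p = [:0, 1:] mod p" by (rule exp_mod_unique) (rule q)
  then obtain s where s: "r = [:0, 1:] + p * s"
    by (metis mod_eq_dvd_iff dvdE diff_eq_eq add.commute)
  obtain r' where r': "r * r' mod p' = 1 mod p'"
    by (rule exp_mod_inverse[OF Suc.prems(1) r])
  \<comment> \<open>As an exponential, \<open>r\<close> is a unit modulo \<open>p'\<close>, so it vanishes at no root of \<open>p'\<close>.\<close>
  have "poly r z \<noteq> 0"
  proof
    assume "poly r z = 0"
    moreover have "[:- z, 1:] dvd r * r' - 1"
      using r' p' by (metis mod_eq_dvd_iff dvd_mult_right)
    ultimately show False by (simp add: poly_eq_0_iff_dvd[symmetric])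
  qed
  define f where "f = - poly s z / poly r z"
  define t where "t = (if a = 0 then f else Ln (1 + f * a) / a)"
  \<comment> \<open>The value \<open>1 + f a\<close> of \<open>1 + f p\<close> at \<open>z\<close> is \<open>z / r(z)\<close>, so it has a logarithm.\<close>
  have "1 + f * a \<noteq> 0"
  proof -
    have "poly r z * (1 + f * a) = z"
      using \<open>poly r z \<noteq> 0\<close> by (simp add: f_def s a_def field_simps)
    then show ?thesis using z by auto
  qed
  then have "exp_mod p' (Polynomial.smult t p) (1 + Polynomial.smult f p)"
    unfolding p' by (intro exp_mod_scaled_idempotent) (auto simp: t_def a_def)
  then have "exp_mod p' (q + Polynomial.smult t p) (r * (1 + Polynomial.smult f p))"
    by (intro exp_mod_add Suc.prems r)
  moreover have "r * (1 + Polynomial.smult f p) mod p' = [:0, 1:] mod p'"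
  proof -
    have "poly (s + Polynomial.smult f r) z = 0"
      using \<open>poly r z \<noteq> 0\<close> by (simp add: f_def)
    then have "p' dvd p * (s + Polynomial.smult f r)"
      unfolding p' poly_eq_0_iff_dvd by (intro mult_dvd_mono dvd_refl)
    also have "p * (s + Polynomial.smult f r) = r * (1 + Polynomial.smult f p) - [:0, 1:]"
    proof -
      have "p * s = r - [:0, 1:]" by (simp add: s)
      then show ?thesis unfolding distrib_left by (simp add: mult.commute[of p r])
    qed
    finally show ?thesis by (simp add: mod_eq_dvd_iff)
  qed
  ultimately have "exp_mod p' (q + Polynomial.smult t p) [:0, 1:]" by (rule exp_mod_cong)
  then show ?case ..
qed


section \<open>Polynomial values in a finite-dimensional complex algebra\<close>

text \<open>A real algebra with a square root of \<open>-1\<close> is a complex algebra, scalars acting through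
  \<open>x + i y \<mapsto> x 1 + y j\<close>.\<close>

locale complex_structure = real_algebra A for A :: "(real, 'a) module" (structure) +
  fixes j
  assumes j_closed [simp]: "j \<in> carrier A"
    and j_square: "j \<otimes> j = \<ominus> \<one>"
begin

sublocale cring A by (rule M_cring)

definition of_complex :: "complex \<Rightarrow> 'a" where
  "of_complex c = Re c \<odot> \<one> \<oplus> Im c \<odot> j"

lemma of_complex_closed [simp]: "of_complex c \<in> carrier A"
  by (simp add: of_complex_def)

lemma of_complex_0 [simp]: "of_complex 0 = \<zero>"
  using smult_l_null[of \<one>] smult_l_null[of j] by (simp add: of_complex_def)

lemma of_complex_1 [simp]: "of_complex 1 = \<one>"
  using smult_one[of \<one>] smult_l_null[of j] by (simp add: of_complex_def)

lemma of_complex_of_real_mult: "x \<in> carrier A \<Longrightarrow> of_complex (of_real r) \<otimes> x = r \<odot> x"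
  using smult_l_null[of j] smult_assoc2[of r \<one> x] by (simp add: of_complex_def)

lemma of_complex_add: "of_complex (c + d) = of_complex c \<oplus> of_complex d"
proof -
  have "(Re c + Re d) \<odot> \<one> = Re c \<odot> \<one> \<oplus> Re d \<odot> \<one>"
    "(Im c + Im d) \<odot> j = Im c \<odot> j \<oplus> Im d \<odot> j"
    using smult_l_distr[of "Re c" "Re d" \<one>] smult_l_distr[of "Im c" "Im d" j] by simp_all
  then show ?thesis
    by (simp add: of_complex_def M.add.m_ac)
qed

lemma smult_mult_smult:
  assumes "x \<in> carrier A" "y \<in> carrier A"
  shows "(r \<odot> x) \<otimes> (s \<odot> y) = (r * s) \<odot> (x \<otimes> y)"
proof -
  have "(r \<odot> x) \<otimes> (s \<odot> y) = r \<odot> (x \<otimes> (s \<odot> y))"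
    using assms by (simp add: smult_assoc2)
  also have "x \<otimes> (s \<odot> y) = s \<odot> (x \<otimes> y)"
    using assms smult_assoc2[of s y x] by (simp add: m_comm)
  finally show ?thesis using assms smult_assoc1[of r s "x \<otimes> y"] by simp
qed

lemma of_complex_mult: "of_complex (c * d) = of_complex c \<otimes> of_complex d"
proof -
  have j: "r \<odot> (j \<otimes> j) = (- r) \<odot> \<one>" for r
    using smult_l_minus[of r \<one>] smult_r_minus[of r \<one>] by (simp add: j_square class_ring_simps)
  have "of_complex c \<otimes> of_complex d
    = ((Re c * Re d) \<odot> \<one> \<oplus> (- (Im c * Im d)) \<odot> \<one>) \<oplus> ((Re c * Im d) \<odot> j \<oplus> (Im c * Re d) \<odot> j)"
    by (simp add: of_complex_def l_distr r_distr smult_mult_smult j M.add.m_ac)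
  also have "\<dots> = of_complex (c * d)"
    using smult_l_distr[of "Re c * Re d" "- (Im c * Im d)" \<one>]
      smult_l_distr[of "Re c * Im d" "Im c * Re d" j]
    by (simp add: of_complex_def)
  finally show ?thesis by simp
qed

text \<open>Evaluation of a complex polynomial at \<open>u\<close> by Horner's scheme.\<close>

definition ev :: "'a \<Rightarrow> complex poly \<Rightarrow> 'a" where
  "ev u p = fold_coeffs (\<lambda>c x. of_complex c \<oplus> u \<otimes> x) p \<zero>"

context
  fixes u assumes u [simp]: "u \<in> carrier A"
begin

lemma ev_0 [simp]: "ev u 0 = \<zero>"
  by (simp add: ev_def)

lemma ev_pCons: "ev u (pCons c p) = of_complex c \<oplus> u \<otimes> ev u p"
  by (cases "c = 0 \<and> p = 0") (auto simp: ev_def)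

lemma ev_closed [simp]: "ev u p \<in> carrier A"
  by (induction p) (simp_all add: ev_pCons)

lemma ev_add: "ev u (p + q) = ev u p \<oplus> ev u q"
  by (induction p q rule: poly_induct2)
     (simp_all add: ev_pCons of_complex_add r_distr M.add.m_ac)

lemma ev_smult: "ev u (Polynomial.smult c p) = of_complex c \<otimes> ev u p"
  by (induction p) (simp_all add: ev_pCons of_complex_mult r_distr m_ac)

lemma ev_mult: "ev u (p * q) = ev u p \<otimes> ev u q"
  by (induction p) (simp_all add: ev_pCons ev_add ev_smult l_distr m_assoc)

lemma ev_1 [simp]: "ev u 1 = \<one>"
  by (simp add: one_pCons ev_pCons)

lemma ev_X [simp]: "ev u [:0, 1:] = u"
  by (simp add: ev_pCons)

lemma ev_power: "ev u (p ^ k) = ev u p [^] k"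
  by (induction k) (simp_all add: ev_mult m_comm)

lemma ev_monom: "ev u (monom c k) = of_complex c \<otimes> u [^] k"
  by (induction k) (simp_all add: monom_0 monom_Suc ev_pCons m_ac)

lemma ev_sum: "finite K \<Longrightarrow> ev u (\<Sum>k\<in>K. f k) = (\<Oplus>k\<in>K. ev u (f k))"
  by (induction K rule: finite_induct) (simp_all add: ev_add)

lemma ev_cong:
  assumes "ev u p = \<zero>" "r mod p = s mod p"
  shows "ev u r = ev u s"
proof -
  obtain t where "r = s + p * t"
    using assms(2) by (metis mod_eq_dvd_iff dvdE diff_eq_eq add.commute)
  then show ?thesis by (simp add: ev_add ev_mult assms(1))
qed

text \<open>Otherwise the powers of \<open>u\<close> up to the dimension would be distinct and linearly independent.\<close>

lemma annihilating_polynomial: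
  obtains p where "p \<noteq> 0" "ev u p = \<zero>"
proof (rule ccontr)
  assume "\<not> thesis"
  then have inj: "p = 0" if "ev u p = \<zero>" for p
    using that \<open>\<And>p. p \<noteq> 0 \<Longrightarrow> ev u p = \<zero> \<Longrightarrow> thesis\<close> by blast
  have inj_pow: "inj_on (\<lambda>k. u [^] k) {..dim}"
  proof (rule inj_onI)
    fix a b :: nat
    assume "u [^] a = u [^] b"
    then have "ev u (monom 1 a) = ev u (monom 1 b)"
      by (simp add: ev_monom)
    then have "ev u (monom 1 a - monom 1 b) \<oplus> ev u (monom 1 b) = \<zero> \<oplus> ev u (monom 1 b)"
      by (simp flip: ev_add)
    then have "ev u (monom 1 a - monom 1 b) = \<zero>"
      by (subst (asm) M.add.right_cancel) simp_all
    then show "a = b" using inj by (metis eq_iff_diff_eq_0 monom_eq_iff' one_neq_zero)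
  qed
  define S where "S = (\<lambda>k. u [^] k) ` {..dim}"
  have S: "finite S" "S \<subseteq> carrier A" by (auto simp: S_def)
  have "lin_indpt S"
  proof (rule finite_lin_indpt2[OF S])
    fix a assume "lincomb a S = \<zero>"
    define f where "f = (\<Sum>k\<le>dim. monom (of_real (a (u [^] k))) k :: complex poly)"
    have "ev u f = (\<Oplus>k\<in>{..dim}. a (u [^] k) \<odot> u [^] k)"
      by (simp add: f_def ev_sum ev_monom of_complex_of_real_mult)
    also have "\<dots> = lincomb a S"
      unfolding lincomb_def S_def by (rule finsum_reindex[symmetric]) (use inj_pow in auto)
    finally have "f = 0" using inj \<open>lincomb a S = \<zero>\<close> by simp
    moreover have "coeff f k = a (u [^] k)" if "k \<le> dim" for k
      using that by (simp add: f_def coeff_sum sum.delta')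
    ultimately show "\<forall>v\<in>S. a v = \<zero>\<^bsub>class_ring\<^esub>"
      by (auto simp: S_def)
  qed
  then have "card S \<le> dim" using li_le_dim[OF finite_dimensional S(2)] by blast
  moreover have "card S = Suc dim" using inj_pow by (simp add: S_def card_image)
  ultimately show False by simp
qed

end

text \<open>Coordinates with respect to a finite basis are linear functionals and determine the vector;
  this makes limits in the algebra unique.\<close>

lemma linear_functional_separates:
  assumes "v \<in> carrier A" "w \<in> carrier A" "v \<noteq> w"
  obtains \<phi> where "\<phi> \<in> LinearCombinations.module_hom class_ring A (class_algebra :: (real, real) module)"
    "\<phi> v \<noteq> \<phi> w"
proof -
  obtain B where B: "finite B" "basis B" using finite_basis_exists[OF finite_dimensional] by blast
  then have BC: "B \<subseteq> carrier A" by (simp add: basis_def)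
  have unique: "\<exists>!a. a \<in> B \<rightarrow>\<^sub>E UNIV \<and> lincomb a B = v" if "v \<in> carrier A" for v
    using basis_criterion[OF B(1) BC] B(2) that by simp
  define coord where "coord v = (THE a. a \<in> B \<rightarrow>\<^sub>E UNIV \<and> lincomb a B = v)" for v
  have coord: "coord v \<in> B \<rightarrow>\<^sub>E UNIV" "lincomb (coord v) B = v" if "v \<in> carrier A" for v
    using theI'[OF unique[OF that]] by (auto simp: coord_def)
  have coordI: "coord v b = a b" if "lincomb a B = v" "b \<in> B" for v a b
  proof -
    have v: "v \<in> carrier A" using that(1) BC lincomb_closed[of B a] by auto
    have "lincomb (restrict a B) B = lincomb a B"
      by (rule lincomb_cong) (use BC in auto)
    then have "coord v = restrict a B"
      unfolding coord_def using that(1) by (intro the1_equality[OF unique[OF v]]) simp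
    then show ?thesis using that(2) by simp
  qed
  have "(\<lambda>v. coord v b) \<in> LinearCombinations.module_hom class_ring A (class_algebra :: (real, real) module)"
    if b: "b \<in> B" for b
    unfolding LinearCombinations.module_hom_def class_algebra_def
  proof (intro CollectI conjI allI impI funcsetI; clarsimp)
    fix v w assume "v \<in> carrier A" "w \<in> carrier A"
    then show "coord (v \<oplus> w) b = coord v b + coord w b"
      using lincomb_sum[OF B(1) BC, of "coord v" "coord w"] coord b by (intro coordI) auto
  next
    fix r v assume "v \<in> carrier A"
    then show "coord (r \<odot> v) b = r * coord v b"
      using lincomb_smult[OF BC, of "coord v" r] coord b by (intro coordI) auto
  qed
  moreover have "\<exists>b\<in>B. coord v b \<noteq> coord w b"
    using coord[OF assms(1)] coord[OF assms(2)] assms(3) by (metis PiE_ext)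
  ultimately show ?thesis using that by blast
qed

lemma algebra_expI:
  assumes "algebra_tendsto A
    (\<lambda>n. \<Oplus>k\<in>{..<n}. (1 / fact k) \<odot> (z [^] (k :: nat))) w"
  shows "algebra_exp A z = w"
  unfolding algebra_exp_def
proof (rule the_equality)
  show "algebra_tendsto A (\<lambda>n. \<Oplus>k\<in>{..<n}. (1 / fact k) \<odot> (z [^] (k :: nat))) w"
    by (rule assms)
next
  fix w' assume w': "algebra_tendsto A (\<lambda>n. \<Oplus>k\<in>{..<n}. (1 / fact k) \<odot> (z [^] (k :: nat))) w'"
  show "w' = w"
  proof (rule ccontr)
    assume "w' \<noteq> w"
    with assms w' obtain \<phi> where
      "\<phi> \<in> LinearCombinations.module_hom class_ring A (class_algebra :: (real, real) module)"
      "\<phi> w' \<noteq> \<phi> w"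
      unfolding algebra_tendsto_def by (metis linear_functional_separates)
    with assms w' show False
      unfolding algebra_tendsto_def by (blast dest: LIMSEQ_unique)
  qed
qed

text \<open>Evaluation at \<open>u\<close> transports exponentials from \<open>\<complex>[X]\<close> modulo an annihilating polynomial
  to the algebra: composing it with a linear functional gives a map to which
  \<open>exp_mod_functional\<close> applies.\<close>

lemma algebra_exp_ev:
  assumes u: "u \<in> carrier A" and p: "p \<noteq> 0" "ev u p = \<zero>" and "exp_mod p q r"
  shows "algebra_exp A (ev u q) = ev u r"
proof (rule algebra_expI, unfold algebra_tendsto_def, intro conjI ballI)
  show "ev u r \<in> carrier A" using u by simp
next
  fix \<phi> assume "\<phi> \<in> LinearCombinations.module_hom class_ring A (class_algebra :: (real, real) module)"
  then have add: "x \<in> carrier A \<Longrightarrow> y \<in> carrier A \<Longrightarrow> \<phi> (x \<oplus> y) = \<phi> x + \<phi> y"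
    and smult: "x \<in> carrier A \<Longrightarrow> \<phi> (r \<odot> x) = r * \<phi> x" for x y r
    by (auto simp: LinearCombinations.module_hom_def class_algebra_def)
  have zero: "\<phi> \<zero> = 0" using add[of \<zero> \<zero>] by simp
  have partial: "\<phi> (\<Oplus>k\<in>{..<n}. (1 / fact k) \<odot> (ev u q [^] k)) = (\<Sum>k<n. \<phi> (ev u (q ^ k)) /\<^sub>R fact k)" for n
    by (induction n)
       (simp_all add: zero lessThan_Suc add smult ev_power u finsum_closed divide_inverse)
  have "(\<lambda>k. \<phi> (ev u (q ^ k)) /\<^sub>R fact k) sums \<phi> (ev u r)"
    by (rule exp_mod_functional[OF p(1) assms(4), of "\<lambda>a. \<phi> (ev u a)"])
       (simp_all add: ev_add ev_smult ev_mult of_complex_of_real_mult add smult zero p(2) u)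
  then show "(\<lambda>n. \<phi> (\<Oplus>k\<in>{..<n}. (1 / fact k) \<odot> (ev u q [^] k))) \<longlonglongrightarrow> \<phi> (ev u r)"
    by (simp add: sums_def partial)
qed

text \<open>Write the argument \<open>z\<close> as the value of \<open>X\<close> at \<open>z\<close>; then \<open>exp z\<close> and \<open>exp (- z)\<close> are values at
  \<open>z\<close> of polynomials that are inverse to each other modulo an annihilating polynomial.\<close>

lemma Ld_subset_Units: "Ld A \<subseteq> Units A"
proof
  fix w assume "w \<in> Ld A"
  then obtain z where z: "z \<in> carrier A" "w = algebra_exp A z" by (auto simp: Ld_def)
  obtain p where p: "p \<noteq> 0" "ev z p = \<zero>" by (rule annihilating_polynomial[OF z(1)])
  obtain r where r: "exp_mod p [:0, 1:] r" by (rule exp_mod_exists[OF p(1)])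
  obtain r' where r': "r * r' mod p = 1 mod p" by (rule exp_mod_inverse[OF p(1) r])
  have w: "w = ev z r" using algebra_exp_ev[OF z(1) p r] z by simp
  have "ev z r \<otimes> ev z r' = \<one>"
    using ev_cong[OF z(1) p(2) r'] z(1) by (simp add: ev_mult)
  then show "w \<in> Units A"
    using z(1) m_comm[of "ev z r" "ev z r'"] unfolding Units_def w by auto
qed

lemma Units_pow: "u \<in> Units A \<Longrightarrow> u [^] (n :: nat) \<in> Units A"
  by (induction n) simp_all

text \<open>Factors \<open>X\<close> of an annihilating polynomial of a unit can be cancelled, so that \<open>0\<close> is not a root
  and \<open>X\<close> has a logarithm \<open>q\<close>; its value at \<open>u\<close> is a logarithm of \<open>u\<close>.\<close>

lemma Units_subset_Ld: "Units A \<subseteq> Ld A"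
proof
  fix u assume U: "u \<in> Units A"
  then have u: "u \<in> carrier A" by (rule Units_closed)
  obtain p' where p': "p' \<noteq> 0" "ev u p' = \<zero>" by (rule annihilating_polynomial[OF u])
  obtain p where p: "p' = [:0, 1:] ^ order 0 p' * p" "\<not> [:0, 1:] dvd p"
    using order_decomp[OF p'(1), of 0] by auto
  have "u [^] order 0 p' \<otimes> ev u p = u [^] order 0 p' \<otimes> \<zero>"
    using p'(2) u by (subst (asm) p(1)) (simp add: ev_mult ev_power)
  then have ev: "ev u p = \<zero>"
    using U u by (subst (asm) Units_l_cancel) (auto intro: Units_pow)
  have "p \<noteq> 0" "poly p 0 \<noteq> 0" using p(2) by (auto simp: poly_eq_0_iff_dvd)
  then obtain q where "exp_mod p q [:0, 1:]" using exp_mod_log by blast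
  from algebra_exp_ev[OF u \<open>p \<noteq> 0\<close> ev this] u have "algebra_exp A (ev u q) = u" by simp
  then show "u \<in> Ld A"
    using u image_eqI[of u "algebra_exp A" "ev u q" "carrier A"] by (simp add: Ld_def)
qed

end


section \<open>The imaginary unit of a type-C algebra\<close>

lemma lookup_map_times [simp]:
  fixes r :: real
  shows "Poly_Mapping.lookup (Poly_Mapping.map ((*) r) f) k = r * Poly_Mapping.lookup f k"
  by (transfer fixing: r) (auto simp: when_def)

lemma map_times_add:
  fixes r :: real
  shows "Poly_Mapping.map ((*) r) (f + g) = Poly_Mapping.map ((*) r) f + Poly_Mapping.map ((*) r) g"
  by (rule poly_mapping_eqI) (simp add: lookup_add distrib_left)

lemma map_times_sum:
  fixes r :: real
  shows "Poly_Mapping.map ((*) r) (\<Sum>x\<in>S. h x) = (\<Sum>x\<in>S. Poly_Mapping.map ((*) r) (h x))"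
  by (rule poly_mapping_eqI) (simp add: lookup_sum sum_distrib_left)

lemma keys_map_times: "Poly_Mapping.keys (Poly_Mapping.map ((*) (r :: real)) f) \<subseteq> Poly_Mapping.keys f"
  by (auto simp: in_keys_iff)

lemma module_pair_algebra: "Module.module (class_ring :: real ring) (pair_algebra A B)"
proof (rule module_criteria)
  show "cring (class_ring :: real ring)" by (rule class_cring.cring_axioms)
  show "\<forall>f\<in>carrier (pair_algebra A B). \<exists>g\<in>carrier (pair_algebra A B).
      f \<oplus>\<^bsub>pair_algebra A B\<^esub> g = \<zero>\<^bsub>pair_algebra A B\<^esub>"
  proof
    fix f assume "f \<in> carrier (pair_algebra A B)"
    then show "\<exists>g\<in>carrier (pair_algebra A B). f \<oplus>\<^bsub>pair_algebra A B\<^esub> g = \<zero>\<^bsub>pair_algebra A B\<^esub>"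
      by (intro bexI[of _ "- f"]) (simp_all add: pair_algebra_def)
  qed
next
  show "\<forall>f g. f \<in> carrier (pair_algebra A B) \<and> g \<in> carrier (pair_algebra A B)
      \<longrightarrow> f \<oplus>\<^bsub>pair_algebra A B\<^esub> g \<in> carrier (pair_algebra A B)"
    using keys_add by (fastforce simp: pair_algebra_def)
qed (auto simp: pair_algebra_def subset_iff in_keys_iff lookup_add algebra_simps
  intro!: poly_mapping_eqI)

locale algebra_pair =
  A: algebra "class_ring :: real ring" A + B: algebra "class_ring :: real ring" B
  for A :: "(real, 'a) module" and B :: "(real, 'b) module"
begin

sublocale P: Module.module "class_ring :: real ring" "pair_algebra A B"
  by (rule module_pair_algebra)

abbreviation \<delta> :: "'a \<Rightarrow> 'b \<Rightarrow> ('a \<times> 'b) \<Rightarrow>\<^sub>0 real" where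
  "\<delta> a b \<equiv> Poly_Mapping.single (a, b) 1"

abbreviation scale :: "real \<Rightarrow> (('a \<times> 'b) \<Rightarrow>\<^sub>0 real) \<Rightarrow> ('a \<times> 'b) \<Rightarrow>\<^sub>0 real" where
  "scale r \<equiv> Poly_Mapping.map ((*) r)"

abbreviation I where "I \<equiv> P.span (tensor_relators A B)"

text \<open>Right multiplication by the basis element of the pair \<open>q\<close>. It is defined on all finitely
  supported functions, so that its linearity needs no carrier conditions.\<close>

definition translate :: "'a \<times> 'b \<Rightarrow> (('a \<times> 'b) \<Rightarrow>\<^sub>0 real) \<Rightarrow> ('a \<times> 'b) \<Rightarrow>\<^sub>0 real" where
  "translate q f = (\<Sum>p \<in> Poly_Mapping.keys f.
    Poly_Mapping.single (fst p \<otimes>\<^bsub>A\<^esub> fst q, snd p \<otimes>\<^bsub>B\<^esub> snd q) (Poly_Mapping.lookup f p))"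

lemma carrier_pair: "f \<in> carrier (pair_algebra A B) \<longleftrightarrow> Poly_Mapping.keys f \<subseteq> carrier A \<times> carrier B"
  and add_pair [simp]: "add (pair_algebra A B) = (+)"
  and zero_pair [simp]: "zero (pair_algebra A B) = 0"
  and smult_pair [simp]: "Module.smult (pair_algebra A B) = scale"
  and one_pair: "one (pair_algebra A B) = \<delta> \<one>\<^bsub>A\<^esub> \<one>\<^bsub>B\<^esub>"
  by (simp_all add: pair_algebra_def fun_eq_iff)

lemma delta_carrier: "a \<in> carrier A \<Longrightarrow> b \<in> carrier B \<Longrightarrow> \<delta> a b \<in> carrier (pair_algebra A B)"
  by (simp add: carrier_pair)

lemma diff_carrier:
  "f \<in> carrier (pair_algebra A B) \<Longrightarrow> g \<in> carrier (pair_algebra A B)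
    \<Longrightarrow> f - g \<in> carrier (pair_algebra A B)"
  using keys_diff[of f g] by (auto simp: carrier_pair)

lemma scale_carrier:
  "f \<in> carrier (pair_algebra A B) \<Longrightarrow> scale r f \<in> carrier (pair_algebra A B)"
  using keys_map_times[of r f] by (auto simp: carrier_pair)

lemma relators_carrier: "tensor_relators A B \<subseteq> carrier (pair_algebra A B)"
  unfolding tensor_relators_def Let_def
  by (auto intro!: diff_carrier delta_carrier scale_carrier simp del: map_single)

lemma submodule_I: "submodule class_ring I (pair_algebra A B)"
  by (rule P.span_is_submodule[OF relators_carrier])

lemma I_0: "0 \<in> I"
  and I_add: "f \<in> I \<Longrightarrow> g \<in> I \<Longrightarrow> f + g \<in> I"
  and I_scale: "f \<in> I \<Longrightarrow> scale r f \<in> I"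
  and I_carrier: "f \<in> I \<Longrightarrow> f \<in> carrier (pair_algebra A B)"
  using submodule.zero_closed[OF submodule_I] submodule.m_closed[OF submodule_I, of f g]
    submodule.smult_closed[OF submodule_I, of r f] submodule.subset[OF submodule_I]
  by auto

lemma I_uminus: "f \<in> I \<Longrightarrow> - f \<in> I"
proof -
  have "scale (- 1) f = - f" by (rule poly_mapping_eqI) simp
  then show "f \<in> I \<Longrightarrow> - f \<in> I" using I_scale[of f "- 1"] by simp
qed

lemma I_diff: "f \<in> I \<Longrightarrow> g \<in> I \<Longrightarrow> f - g \<in> I"
  using I_add[OF _ I_uminus, of f g] by simp

lemma I_sum: "(\<And>x. x \<in> S \<Longrightarrow> f x \<in> I) \<Longrightarrow> sum f S \<in> I"
  by (induction S rule: infinite_finite_induct) (auto intro: I_0 I_add)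

lemma I_relator: "f \<in> tensor_relators A B \<Longrightarrow> f \<in> I"
  using P.in_own_span[OF relators_carrier] by auto

lemma translate_superset:
  assumes "finite S" "Poly_Mapping.keys f \<subseteq> S"
  shows "translate q f = (\<Sum>p\<in>S.
    Poly_Mapping.single (fst p \<otimes>\<^bsub>A\<^esub> fst q, snd p \<otimes>\<^bsub>B\<^esub> snd q) (Poly_Mapping.lookup f p))"
  unfolding translate_def using assms
  by (intro sum.mono_neutral_left) (auto simp: in_keys_iff)

lemma translate_add: "translate q (f + g) = translate q f + translate q g"
proof -
  let ?S = "Poly_Mapping.keys f \<union> Poly_Mapping.keys g"
  have "finite ?S" "Poly_Mapping.keys (f + g) \<subseteq> ?S" by (simp_all add: keys_add)
  then show ?thesis
    using translate_superset[of ?S f] translate_superset[of ?S g] translate_superset[of ?S "f + g"]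
    by (simp add: lookup_add single_add sum.distrib)
qed

lemma translate_scale: "translate q (scale r f) = scale r (translate q f)"
  unfolding translate_superset[OF finite_keys keys_map_times]
  by (simp add: translate_def map_times_sum)

lemma translate_diff: "translate q (f - g) = translate q f - translate q g"
  using translate_add[of q "f - g" g] by (simp add: eq_diff_eq)

lemma translate_0 [simp]: "translate q 0 = 0"
  by (simp add: translate_def)

lemma translate_delta [simp]:
  "translate q (\<delta> a b) = \<delta> (a \<otimes>\<^bsub>A\<^esub> fst q) (b \<otimes>\<^bsub>B\<^esub> snd q)"
  by (simp add: translate_def)

text \<open>Multiplying a bilinearity relator by a pair gives the relator of the same kind for the
  multiplied entries, by distributivity and compatibility of scalars with products.\<close>

lemma translate_relator:
  assumes "f \<in> tensor_relators A B" "c \<in> carrier A" "d \<in> carrier B"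
  shows "translate (c, d) f \<in> tensor_relators A B"
proof -
  let ?R = "tensor_relators A B"
  have R1: "\<delta> (a \<oplus>\<^bsub>A\<^esub> a') b - \<delta> a b - \<delta> a' b \<in> ?R"
    if "a \<in> carrier A" "a' \<in> carrier A" "b \<in> carrier B" for a a' b
    using that unfolding tensor_relators_def Let_def by blast
  have R2: "\<delta> a (b \<oplus>\<^bsub>B\<^esub> b') - \<delta> a b - \<delta> a b' \<in> ?R"
    if "a \<in> carrier A" "b \<in> carrier B" "b' \<in> carrier B" for a b b'
    using that unfolding tensor_relators_def Let_def by blast
  have R3: "\<delta> (r \<odot>\<^bsub>A\<^esub> a) b - scale r (\<delta> a b) \<in> ?R"
    if "a \<in> carrier A" "b \<in> carrier B" for a b r
    using that unfolding tensor_relators_def Let_def by blast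
  have R4: "\<delta> a (r \<odot>\<^bsub>B\<^esub> b) - scale r (\<delta> a b) \<in> ?R"
    if "a \<in> carrier A" "b \<in> carrier B" for a b r
    using that unfolding tensor_relators_def Let_def by blast
  from assms(1)[unfolded tensor_relators_def Let_def] show ?thesis
  proof (elim UnE CollectE exE conjE)
    fix a a' b assume "f = \<delta> (a \<oplus>\<^bsub>A\<^esub> a') b - \<delta> a b - \<delta> a' b"
      "a \<in> carrier A" "a' \<in> carrier A" "b \<in> carrier B"
    then show ?thesis
      using assms(2,3) R1[of "a \<otimes>\<^bsub>A\<^esub> c" "a' \<otimes>\<^bsub>A\<^esub> c" "b \<otimes>\<^bsub>B\<^esub> d"]
      by (simp add: translate_diff A.l_distr)
  next
    fix a b b' assume "f = \<delta> a (b \<oplus>\<^bsub>B\<^esub> b') - \<delta> a b - \<delta> a b'"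
      "a \<in> carrier A" "b \<in> carrier B" "b' \<in> carrier B"
    then show ?thesis
      using assms(2,3) R2[of "a \<otimes>\<^bsub>A\<^esub> c" "b \<otimes>\<^bsub>B\<^esub> d" "b' \<otimes>\<^bsub>B\<^esub> d"]
      by (simp add: translate_diff B.l_distr)
  next
    fix r a b assume "f = \<delta> (r \<odot>\<^bsub>A\<^esub> a) b - scale r (\<delta> a b)"
      "a \<in> carrier A" "b \<in> carrier B"
    then show ?thesis
      using assms(2,3) R3[of "a \<otimes>\<^bsub>A\<^esub> c" "b \<otimes>\<^bsub>B\<^esub> d" r]
      by (simp add: translate_diff translate_scale A.smult_assoc2 del: map_single)
  next
    fix r a b assume "f = \<delta> a (r \<odot>\<^bsub>B\<^esub> b) - scale r (\<delta> a b)"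
      "a \<in> carrier A" "b \<in> carrier B"
    then show ?thesis
      using assms(2,3) R4[of "a \<otimes>\<^bsub>A\<^esub> c" "b \<otimes>\<^bsub>B\<^esub> d" r]
      by (simp add: translate_diff translate_scale B.smult_assoc2 del: map_single)
  qed
qed

lemma translate_I:
  assumes "f \<in> I" "c \<in> carrier A" "d \<in> carrier B"
  shows "translate (c, d) f \<in> I"
proof -
  let ?N = "{f \<in> carrier (pair_algebra A B). translate (c, d) f \<in> I}"
  have "submodule class_ring ?N (pair_algebra A B)"
  proof
    show "?N \<subseteq> carrier (pair_algebra A B)" by blast
  next
    fix v w assume "v \<in> ?N" "w \<in> ?N"
    then show "v \<oplus>\<^bsub>pair_algebra A B\<^esub> w \<in> ?N"
      using P.M.a_closed[of v w] by (simp add: translate_add I_add)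
  next
    show "\<zero>\<^bsub>pair_algebra A B\<^esub> \<in> ?N" using P.M.zero_closed by (simp add: I_0)
  next
    fix r v assume "v \<in> ?N"
    then show "r \<odot>\<^bsub>pair_algebra A B\<^esub> v \<in> ?N"
      by (simp add: scale_carrier translate_scale I_scale)
  qed
  moreover have "tensor_relators A B \<subseteq> ?N"
    using relators_carrier translate_relator assms by (auto intro: I_relator)
  ultimately have "I \<subseteq> ?N" by (intro P.span_is_subset)
  then show ?thesis using assms(1) by auto
qed

lemma mult_eq_sum_translate:
  "f \<otimes>\<^bsub>pair_algebra A B\<^esub> g
    = (\<Sum>q \<in> Poly_Mapping.keys g. scale (Poly_Mapping.lookup g q) (translate q f))"
  unfolding pair_algebra_def translate_def
  by (simp add: sum.swap[of _ "Poly_Mapping.keys f"] map_times_sum mult.commute)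

lemma mult_add_left:
  "(f + f') \<otimes>\<^bsub>pair_algebra A B\<^esub> g
    = f \<otimes>\<^bsub>pair_algebra A B\<^esub> g + f' \<otimes>\<^bsub>pair_algebra A B\<^esub> g"
  by (simp add: mult_eq_sum_translate translate_add map_times_add sum.distrib)

lemma mult_commute:
  assumes "f \<in> carrier (pair_algebra A B)" "g \<in> carrier (pair_algebra A B)"
  shows "f \<otimes>\<^bsub>pair_algebra A B\<^esub> g = g \<otimes>\<^bsub>pair_algebra A B\<^esub> f"
proof -
  have "fst p \<otimes>\<^bsub>A\<^esub> fst q = fst q \<otimes>\<^bsub>A\<^esub> fst p" "snd p \<otimes>\<^bsub>B\<^esub> snd q = snd q \<otimes>\<^bsub>B\<^esub> snd p"
    if "p \<in> Poly_Mapping.keys f" "q \<in> Poly_Mapping.keys g" for p q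
    using assms that
    by (cases p; cases q; auto simp: carrier_pair subset_iff intro: A.m_comm B.m_comm)+
  then show ?thesis
    unfolding pair_algebra_def
    by (simp add: sum.swap[of _ "Poly_Mapping.keys g"] mult.commute cong: sum.cong)
qed

lemma mult_delta:
  "\<delta> a b \<otimes>\<^bsub>pair_algebra A B\<^esub> \<delta> c d = \<delta> (a \<otimes>\<^bsub>A\<^esub> c) (b \<otimes>\<^bsub>B\<^esub> d)"
  by (simp add: mult_eq_sum_translate)

lemma I_absorbs:
  assumes "f \<in> I" "g \<in> carrier (pair_algebra A B)"
  shows "f \<otimes>\<^bsub>pair_algebra A B\<^esub> g \<in> I"
  unfolding mult_eq_sum_translate
proof (rule I_sum)
  fix q assume "q \<in> Poly_Mapping.keys g"
  then have "fst q \<in> carrier A" "snd q \<in> carrier B" using assms(2) by (auto simp: carrier_pair)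
  then show "scale (Poly_Mapping.lookup g q) (translate q f) \<in> I"
    using translate_I[OF assms(1), of "fst q" "snd q"] by (simp add: I_scale)
qed

definition coset :: "(('a \<times> 'b) \<Rightarrow>\<^sub>0 real) \<Rightarrow> (('a \<times> 'b) \<Rightarrow>\<^sub>0 real) set" where
  "coset f = I +>\<^bsub>pair_algebra A B\<^esub> f"

lemma coset_eq: "coset f = {h + f |h. h \<in> I}"
  by (auto simp: coset_def a_r_coset_def')

lemma in_coset_iff: "g \<in> coset f \<longleftrightarrow> g - f \<in> I"
  by (auto simp: coset_eq) (metis diff_add_cancel)

lemma coset_cong:
  assumes "f - g \<in> I"
  shows "coset f = coset g"
proof -
  have "h - f \<in> I \<longleftrightarrow> h - g \<in> I" for h
    using I_add[OF _ assms, of "h - f"] I_diff[OF _ assms, of "h - g"] by (auto simp: algebra_simps)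
  then show ?thesis by (auto simp: in_coset_iff)
qed

lemma coset_of_I: "f \<in> I \<Longrightarrow> coset f = I"
  using coset_cong[of f 0] by (auto simp: coset_eq)

lemma tensor_carrier: "f \<in> carrier (pair_algebra A B) \<Longrightarrow> coset f \<in> carrier (tensor_algebra A B)"
  by (auto simp: tensor_algebra_def Let_def FactRing_def ring.extend_def module.fields_def
    A_RCOSETS_def' coset_def ring.defs)

lemma tensor_zero: "\<zero>\<^bsub>tensor_algebra A B\<^esub> = coset 0"
  by (simp add: tensor_algebra_def Let_def FactRing_def ring.defs coset_of_I I_0)

lemma tensor_one: "\<one>\<^bsub>tensor_algebra A B\<^esub> = coset (\<delta> \<one>\<^bsub>A\<^esub> \<one>\<^bsub>B\<^esub>)"
  by (simp add: tensor_algebra_def Let_def FactRing_def ring.defs coset_def one_pair)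

lemma tensor_add: "coset f \<oplus>\<^bsub>tensor_algebra A B\<^esub> coset g = coset (f + g)"
proof -
  have "coset f \<oplus>\<^bsub>tensor_algebra A B\<^esub> coset g = {a + b |a b. a \<in> coset f \<and> b \<in> coset g}"
    by (auto simp: tensor_algebra_def Let_def FactRing_def ring.defs set_add_def')
  also have "\<dots> = coset (f + g)"
  proof (intro equalityI subsetI)
    fix h assume "h \<in> coset (f + g)"
    then have "h - g \<in> coset f" by (simp add: in_coset_iff diff_diff_eq add.commute)
    moreover have "g \<in> coset g" by (simp add: in_coset_iff I_0)
    ultimately show "h \<in> {a + b |a b. a \<in> coset f \<and> b \<in> coset g}"
      by (intro CollectI exI[of _ "h - g"] exI[of _ g]) simp
  next
    fix h assume "h \<in> {a + b |a b. a \<in> coset f \<and> b \<in> coset g}"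
    then obtain a b where "h = a + b" "a - f \<in> I" "b - g \<in> I" by (auto simp: in_coset_iff)
    then show "h \<in> coset (f + g)"
      using I_add[of "a - f" "b - g"] by (simp add: in_coset_iff algebra_simps)
  qed
  finally show ?thesis .
qed

text \<open>Representatives may be changed because \<open>I\<close> absorbs products; commutativity of the factors
  reduces absorption from the left to absorption from the right.\<close>

lemma tensor_mult:
  assumes f: "f \<in> carrier (pair_algebra A B)" and g: "g \<in> carrier (pair_algebra A B)"
  shows "coset f \<otimes>\<^bsub>tensor_algebra A B\<^esub> coset g = coset (f \<otimes>\<^bsub>pair_algebra A B\<^esub> g)"
proof -
  have representatives:
    "coset (a \<otimes>\<^bsub>pair_algebra A B\<^esub> b) = coset (f \<otimes>\<^bsub>pair_algebra A B\<^esub> g)"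
    if ab: "a \<in> coset f" "b \<in> coset g" for a b
  proof (rule coset_cong)
    have a: "a - f \<in> I" and b: "b - g \<in> I" using ab by (simp_all add: in_coset_iff)
    have b_carrier: "b \<in> carrier (pair_algebra A B)"
      using P.M.a_closed[OF I_carrier[OF b] g] by simp
    have "a \<otimes>\<^bsub>pair_algebra A B\<^esub> b
        = (a - f) \<otimes>\<^bsub>pair_algebra A B\<^esub> b + f \<otimes>\<^bsub>pair_algebra A B\<^esub> b"
      by (simp flip: mult_add_left)
    also have "f \<otimes>\<^bsub>pair_algebra A B\<^esub> b
        = (b - g) \<otimes>\<^bsub>pair_algebra A B\<^esub> f + g \<otimes>\<^bsub>pair_algebra A B\<^esub> f"
      using mult_commute[OF f b_carrier] by (simp flip: mult_add_left)
    finally show "a \<otimes>\<^bsub>pair_algebra A B\<^esub> b - f \<otimes>\<^bsub>pair_algebra A B\<^esub> g \<in> I"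
      using I_add[OF I_absorbs[OF a b_carrier] I_absorbs[OF b f]] mult_commute[OF f g]
      by (simp add: add.assoc)
  qed
  have nonempty: "f \<in> coset f" "g \<in> coset g" by (simp_all add: in_coset_iff I_0)
  have "coset f \<otimes>\<^bsub>tensor_algebra A B\<^esub> coset g
      = (\<Union>a\<in>coset f. \<Union>b\<in>coset g. coset (a \<otimes>\<^bsub>pair_algebra A B\<^esub> b))"
    by (simp add: tensor_algebra_def Let_def FactRing_def ring.defs rcoset_mult_def coset_def)
  also have "\<dots> = (\<Union>a\<in>coset f. \<Union>b\<in>coset g. coset (f \<otimes>\<^bsub>pair_algebra A B\<^esub> g))"
    by (intro SUP_cong refl representatives)
  also have "\<dots> = coset (f \<otimes>\<^bsub>pair_algebra A B\<^esub> g)"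
    using nonempty by blast
  finally show ?thesis .
qed

end

lemma algebra_class_algebra:
  "algebra (class_ring :: real ring) (class_algebra :: (real, 'c :: {real_algebra_1, comm_ring_1}) module)"
proof (rule algebraI)
  show "cring (class_ring :: real ring)" by (rule class_cring.cring_axioms)
  show "cring (class_algebra :: (real, 'c) module)"
  proof (intro cringI abelian_groupI comm_monoidI)
    fix x :: 'c
    show "\<exists>y\<in>carrier class_algebra. y \<oplus>\<^bsub>class_algebra\<^esub> x = \<zero>\<^bsub>class_algebra\<^esub>"
      by (intro bexI[of _ "- x"]) (simp_all add: class_algebra_def)
  qed (simp_all add: class_algebra_def algebra_simps)
qed (simp_all add: class_algebra_def algebra_simps)

text \<open>The element is \<open>i \<otimes> 1\<close>. The last two conclusions stand in for the ring axioms of the tensor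
  product: they suffice to recognise its zero in an isomorphic ring.\<close>

lemma tensor_complex_imaginary_unit:
  fixes B :: "(real, 'b) module"
  defines "T \<equiv> tensor_algebra (class_algebra :: (real, complex) module) B"
  assumes "algebra (class_ring :: real ring) B"
  obtains x where "x \<in> carrier T" "x \<otimes>\<^bsub>T\<^esub> x \<oplus>\<^bsub>T\<^esub> \<one>\<^bsub>T\<^esub> = \<zero>\<^bsub>T\<^esub>"
    and "\<zero>\<^bsub>T\<^esub> \<in> carrier T" "\<zero>\<^bsub>T\<^esub> \<oplus>\<^bsub>T\<^esub> \<zero>\<^bsub>T\<^esub> = \<zero>\<^bsub>T\<^esub>"
proof -
  let ?C = "class_algebra :: (real, complex) module"
  let ?one = "\<one>\<^bsub>B\<^esub>"
  interpret algebra_pair ?C B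
    by (intro algebra_pair.intro algebra_class_algebra assms)
  have delta: "\<delta> z ?one \<in> carrier (pair_algebra ?C B)" for z
    by (rule delta_carrier) (simp_all add: class_algebra_def)
  \<comment> \<open>Additivity applied to \<open>-1 + 1 = 0\<close> reduces this to \<open>0 \<otimes> 1 = 0\<close>, an instance of the scalar
    relator.\<close>
  have "\<delta> (- 1) ?one + \<delta> 1 ?one \<in> I"
  proof -
    let ?r = "\<delta> (- 1 \<oplus>\<^bsub>?C\<^esub> 1) ?one - \<delta> (- 1) ?one - \<delta> 1 ?one"
    let ?s = "\<delta> (0 \<odot>\<^bsub>?C\<^esub> 1) ?one - scale 0 (\<delta> 1 ?one)"
    have carrier: "z \<in> carrier ?C" for z by (simp add: class_algebra_def)
    have "?r \<in> tensor_relators ?C B" "?s \<in> tensor_relators ?C B"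
      unfolding tensor_relators_def Let_def using carrier B.one_closed by blast+
    then have "?s - ?r \<in> I" by (intro I_diff I_relator)
    moreover have "- 1 \<oplus>\<^bsub>?C\<^esub> 1 = 0" "0 \<odot>\<^bsub>?C\<^esub> 1 = 0" by (simp_all add: class_algebra_def)
    ultimately show ?thesis by (simp add: add.commute)
  qed
  then have "coset (\<delta> (- 1) ?one + \<delta> 1 ?one) = coset 0"
    by (intro coset_cong) simp
  moreover have "coset (\<delta> \<i> ?one) \<otimes>\<^bsub>T\<^esub> coset (\<delta> \<i> ?one) = coset (\<delta> (- 1) ?one)"
    using mult_delta[of \<i> ?one \<i> ?one]
    by (simp add: T_def tensor_mult[OF delta delta]) (simp add: class_algebra_def)
  moreover have "\<one>\<^bsub>T\<^esub> = coset (\<delta> 1 ?one)"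
    by (simp add: T_def tensor_one) (simp add: class_algebra_def)
  ultimately show thesis
    using that[of "coset (\<delta> \<i> ?one)"] tensor_carrier[OF delta] tensor_carrier[OF I_carrier[OF I_0]]
    by (simp add: T_def tensor_add tensor_zero)
qed

lemma type_C_imaginary_unit:
  fixes A :: "(real, 'a) module"
  assumes "real_algebra A" "type_C TYPE('b) A"
  obtains j where "j \<in> carrier A" "j \<otimes>\<^bsub>A\<^esub> j = \<ominus>\<^bsub>A\<^esub> \<one>\<^bsub>A\<^esub>"
proof -
  have "algebra class_ring A" using assms(1) by (simp add: real_algebra_def)
  then interpret cring A by (rule algebra.M_cring)
  obtain B :: "(real, 'b) module" and h where B: "real_algebra B"
    and h: "h \<in> algebra_iso A (tensor_algebra (class_algebra :: (real, complex) module) B)"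
    using assms(2) by (auto simp: type_C_def)
  let ?T = "tensor_algebra (class_algebra :: (real, complex) module) B"
  have "algebra class_ring B" using B by (simp add: real_algebra_def)
  then obtain x where x: "x \<in> carrier ?T" "x \<otimes>\<^bsub>?T\<^esub> x \<oplus>\<^bsub>?T\<^esub> \<one>\<^bsub>?T\<^esub> = \<zero>\<^bsub>?T\<^esub>"
    and zero: "\<zero>\<^bsub>?T\<^esub> \<in> carrier ?T" "\<zero>\<^bsub>?T\<^esub> \<oplus>\<^bsub>?T\<^esub> \<zero>\<^bsub>?T\<^esub> = \<zero>\<^bsub>?T\<^esub>"
    by (rule tensor_complex_imaginary_unit)
  have bij: "bij_betw h (carrier A) (carrier ?T)" and hom: "h \<in> Ring.ring_hom A ?T"
    using h by (auto simp: algebra_iso_def ring_iso_def)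
  obtain j n where j: "j \<in> carrier A" "h j = x" and n: "n \<in> carrier A" "h n = \<zero>\<^bsub>?T\<^esub>"
    using bij x(1) zero(1) by (metis bij_betw_imp_surj_on imageE)
  have inj: "a = b" if "h a = h b" "a \<in> carrier A" "b \<in> carrier A" for a b
    using bij that by (auto simp: bij_betw_def inj_on_def)
  \<comment> \<open>A ring homomorphism into a structure not known to be a ring need not visibly preserve zero;
    but the preimage \<open>n\<close> of zero is additively idempotent.\<close>
  have "n \<oplus>\<^bsub>A\<^esub> n = n"
    by (rule inj) (simp_all add: n ring_hom_add[OF hom] zero)
  then have n0: "n = \<zero>\<^bsub>A\<^esub>" using n(1) by (simp add: add.l_cancel_one)
  have "h (j \<otimes>\<^bsub>A\<^esub> j \<oplus>\<^bsub>A\<^esub> \<one>\<^bsub>A\<^esub>) = h n"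
    by (simp add: ring_hom_add[OF hom] ring_hom_mult[OF hom] ring_hom_one[OF hom] j n x)
  then have "j \<otimes>\<^bsub>A\<^esub> j \<oplus>\<^bsub>A\<^esub> \<one>\<^bsub>A\<^esub> = \<zero>\<^bsub>A\<^esub>"
    using j n n0 by (intro inj) simp_all
  then have "\<ominus>\<^bsub>A\<^esub> \<one>\<^bsub>A\<^esub> = j \<otimes>\<^bsub>A\<^esub> j"
    using j by (intro minus_equality) simp_all
  then have "j \<otimes>\<^bsub>A\<^esub> j = \<ominus>\<^bsub>A\<^esub> \<one>\<^bsub>A\<^esub>" ..
  with j that show ?thesis by blast
qed


section \<open>Units are exponentials\<close>

theorem proposition2p21:
  fixes A :: "(real, 'a) module"
  assumes "real_algebra A"
    and "multiplicative_algebra A"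
    and "type_C TYPE('b) A"
  shows "Ld A = Units A"
proof -
  obtain j where "j \<in> carrier A" "j \<otimes>\<^bsub>A\<^esub> j = \<ominus>\<^bsub>A\<^esub> \<one>\<^bsub>A\<^esub>"
    by (rule type_C_imaginary_unit[OF assms(1,3)])
  then interpret complex_structure A j
    by (intro complex_structure.intro complex_structure_axioms.intro assms(1))
  show ?thesis
    by (intro equalityI Ld_subset_Units Units_subset_Ld)
qed

end
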